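(* Let $X,Y,Z$ be sets with equivalence relations $R_X,R_Y,R_Z$ respectively. Let $K:X\to\mathcal{D}(Y)$ be an $(R_X,R_Y)$-compatible kernel and $L:Y\to\mathcal{D}(Z)$ an $(R_Y,R_Z)$-compatible kernel. Then the sequential composition $K;L$ is $(R_X,R_Z)$-compatible and $$\overline{K;L}=\overline K;\overline L$$ as kernels $X/R_X\to\mathcal{D}(Z/R_Z)$.
   Context: For a set $X$, $\mathcal{D}(X)$ denotes the set of finitely supported probability distributions on $X$. A kernel from $X$ to $Y$ is a function $K:X\to\mathcal{D}(Y)$; its affine extension is $K^{\dagger}(\mu)(y)=\sum_x\mu(x)K(x)(y)$ for $\mu\in\mathcal{D}(X)$. For $K:X\to\mathcal{D}(Y)$ and $L:Y\to\mathcal{D}(Z)$, sequential composition is $(K;L)(x)=L^{\dagger}(K(x))$. For an equivalence relation $R_Y$ on $Y$ with quotient map $q_Y:Y\to Y/R_Y$ and $\mu,\nu\in\mathcal{D}(Y)$, write $\mu\,\overline{R_Y}\,\nu$ iff $\mu(E)=\nu(E)$ for every class $E\in Y/R_Y$, equivalently the pushforwards satisfy $(q_Y)_{\#}\mu=(q_Y)_{\#}\nu$. A kernel $K:X\to\mathcal{D}(Y)$ is $(R_X,R_Y)$-compatible when $x\,R_X\,x'$ implies $K(x)\,\overline{R_Y}\,K(x')$. For such a compatible kernel, the quotient kernel $\overline K:X/R_X\to\mathcal{D}(Y/R_Y)$ is the (well-defined) kernel $\overline K([x])=(q_Y)_{\#}(K(x))$; similarly for $\overline L$ and $\overline{K;L}$.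 *)

theory Defs
  imports "HOL-Probability.Probability_Mass_Function" "HOL-Library.FuncSet"
begin

definition fin_dists :: "'a set \<Rightarrow> 'a pmf set" where
  "fin_dists X = {\<mu>. finite (set_pmf \<mu>) \<and> set_pmf \<mu> \<subseteq> X}"

text \<open>Kernels are extensional outside their carrier, so that equality of kernels on a carrier
  \<open>X\<close> is plain equality of HOL functions.\<close>

definition kernels :: "'a set \<Rightarrow> 'b set \<Rightarrow> ('a \<Rightarrow> 'b pmf) set" where
  "kernels X Y = X \<rightarrow>\<^sub>E fin_dists Y"

definition affine_ext :: "('a \<Rightarrow> 'b pmf) \<Rightarrow> 'a pmf \<Rightarrow> 'b pmf" where
  "affine_ext K \<mu> = bind_pmf \<mu> K"

lemma pmf_affine_ext:
  assumes "\<mu> \<in> fin_dists X"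
  shows "pmf (affine_ext K \<mu>) y = (\<Sum>x\<in>set_pmf \<mu>. pmf \<mu> x * pmf (K x) y)"
  using assms unfolding affine_ext_def fin_dists_def pmf_bind
  by (subst integral_measure_pmf[where A = "set_pmf \<mu>"]) auto

definition seq_comp :: "'a set \<Rightarrow> ('a \<Rightarrow> 'b pmf) \<Rightarrow> ('b \<Rightarrow> 'c pmf) \<Rightarrow> 'a \<Rightarrow> 'c pmf" where
  "seq_comp X K L = (\<lambda>x\<in>X. affine_ext L (K x))"

lemma seq_comp_in_kernels:
  assumes "K \<in> kernels X Y" and "L \<in> kernels Y Z"
  shows "seq_comp X K L \<in> kernels X Z"
  using assms unfolding kernels_def seq_comp_def affine_ext_def fin_dists_def
  by (fastforce simp: PiE_iff)

definition class_eq :: "'a set \<Rightarrow> 'a rel \<Rightarrow> 'a pmf \<Rightarrow> 'a pmf \<Rightarrow> bool" where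
  "class_eq Y R \<mu> \<nu> \<longleftrightarrow> (\<forall>E\<in>Y // R. measure_pmf.prob \<mu> E = measure_pmf.prob \<nu> E)"

definition push_quot :: "'a rel \<Rightarrow> 'a pmf \<Rightarrow> 'a set pmf" where
  "push_quot R \<mu> = map_pmf (\<lambda>y. R `` {y}) \<mu>"

lemma push_quot_in_fin_dists:
  "\<mu> \<in> fin_dists Y \<Longrightarrow> push_quot R \<mu> \<in> fin_dists (Y // R)"
  by (auto simp: fin_dists_def push_quot_def intro: quotientI)

lemma pmf_push_quot:
  assumes "equiv Y R" and "\<mu> \<in> fin_dists Y" and "E \<in> Y // R"
  shows "pmf (push_quot R \<mu>) E = measure_pmf.prob \<mu> E"
proof -
  have "y \<in> (\<lambda>y. R `` {y}) -` {E} \<longleftrightarrow> y \<in> E" if "y \<in> set_pmf \<mu>" for y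
    using assms that unfolding fin_dists_def
    by (auto simp: quotient_def equiv_class_eq_iff)
  then show ?thesis
    unfolding push_quot_def pmf_map
    by (intro measure_pmf.finite_measure_eq_AE) (auto simp: AE_measure_pmf_iff)
qed

lemma class_eq_iff_push_quot:
  assumes "equiv Y R" and "\<mu> \<in> fin_dists Y" and "\<nu> \<in> fin_dists Y"
  shows "class_eq Y R \<mu> \<nu> \<longleftrightarrow> push_quot R \<mu> = push_quot R \<nu>"
proof
  assume *: "class_eq Y R \<mu> \<nu>"
  show "push_quot R \<mu> = push_quot R \<nu>"
  proof (rule pmf_eqI)
    fix E
    show "pmf (push_quot R \<mu>) E = pmf (push_quot R \<nu>) E"
    proof (cases "E \<in> Y // R")
      case True
      then show ?thesis using * assms by (simp add: class_eq_def pmf_push_quot)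
    next
      case False
      then have "E \<notin> set_pmf (push_quot R \<mu>)" "E \<notin> set_pmf (push_quot R \<nu>)"
        using assms(2,3)[THEN push_quot_in_fin_dists[where R = R]] by (auto simp: fin_dists_def)
      then show ?thesis by (simp add: set_pmf_iff)
    qed
  qed
next
  assume "push_quot R \<mu> = push_quot R \<nu>"
  then show "class_eq Y R \<mu> \<nu>"
    using assms unfolding class_eq_def by (metis pmf_push_quot)
qed

definition compatible_kernels ::
  "'a set \<Rightarrow> 'a rel \<Rightarrow> 'b set \<Rightarrow> 'b rel \<Rightarrow> ('a \<Rightarrow> 'b pmf) set" where
  "compatible_kernels X R\<^sub>X Y R\<^sub>Y =
     {K \<in> kernels X Y. \<forall>x x'. (x, x') \<in> R\<^sub>X \<longrightarrow> class_eq Y R\<^sub>Y (K x) (K x')}"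

text \<open>The quotient kernel evaluates \<open>K\<close> at a chosen representative of the class; for compatible
  kernels the choice is irrelevant, as the next lemma shows.\<close>

definition quot_kernel ::
  "'a set \<Rightarrow> 'a rel \<Rightarrow> 'b rel \<Rightarrow> ('a \<Rightarrow> 'b pmf) \<Rightarrow> 'a set \<Rightarrow> 'b set pmf" where
  "quot_kernel X R\<^sub>X R\<^sub>Y K = (\<lambda>C\<in>X // R\<^sub>X. push_quot R\<^sub>Y (K (SOME x. x \<in> C)))"

lemma quot_kernel_class:
  assumes "equiv X R\<^sub>X" and "equiv Y R\<^sub>Y" and "K \<in> compatible_kernels X R\<^sub>X Y R\<^sub>Y" and "x \<in> X"
  shows "quot_kernel X R\<^sub>X R\<^sub>Y K (R\<^sub>X `` {x}) = push_quot R\<^sub>Y (K x)"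
proof -
  define x' where "x' = (SOME x'. x' \<in> R\<^sub>X `` {x})"
  have "x' \<in> R\<^sub>X `` {x}"
    unfolding x'_def by (rule someI[of _ x]) (rule equiv_class_self[OF assms(1,4)])
  then have xx': "(x, x') \<in> R\<^sub>X" by simp
  then have "x' \<in> X" using assms(1) by (auto simp: equiv_def refl_on_def)
  then have "push_quot R\<^sub>Y (K x) = push_quot R\<^sub>Y (K x')"
    using assms xx' class_eq_iff_push_quot[OF assms(2), of "K x" "K x'"]
    by (auto simp: compatible_kernels_def kernels_def)
  then show ?thesis
    using assms(4) unfolding x'_def by (simp add: quot_kernel_def quotientI)
qed

lemma quot_kernel_in_kernels:
  assumes "equiv X R\<^sub>X" and "equiv Y R\<^sub>Y" and "K \<in> compatible_kernels X R\<^sub>X Y R\<^sub>Y"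
  shows "quot_kernel X R\<^sub>X R\<^sub>Y K \<in> kernels (X // R\<^sub>X) (Y // R\<^sub>Y)"
  unfolding kernels_def
proof (rule PiE_I)
  fix C assume "C \<in> X // R\<^sub>X"
  then obtain x where x: "x \<in> X" "C = R\<^sub>X `` {x}" by (rule quotientE)
  then show "quot_kernel X R\<^sub>X R\<^sub>Y K C \<in> fin_dists (Y // R\<^sub>Y)"
    using quot_kernel_class[OF assms x(1)] assms(3)
    by (auto simp: compatible_kernels_def kernels_def intro!: push_quot_in_fin_dists)
qed (simp add: quot_kernel_def)

end

theory Submission
  imports Defs
begin

text \<open>Pushing forward to the quotient intertwines the affine extension of \<open>L\<close> with that of its
  quotient kernel. Hence the class of \<open>(K; L)(x)\<close> depends on \<open>K(x)\<close> only through its pushforward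
  to \<open>Y/R\<^sub>Y\<close>, which gives both compatibility and the formula for the quotient.\<close>

lemma push_quot_affine_ext:
  assumes "equiv Y R\<^sub>Y" and "equiv Z R\<^sub>Z" and "L \<in> compatible_kernels Y R\<^sub>Y Z R\<^sub>Z"
    and "\<mu> \<in> fin_dists Y"
  shows "push_quot R\<^sub>Z (affine_ext L \<mu>)
    = affine_ext (quot_kernel Y R\<^sub>Y R\<^sub>Z L) (push_quot R\<^sub>Y \<mu>)"
proof -
  have "push_quot R\<^sub>Z (affine_ext L \<mu>) = bind_pmf \<mu> (\<lambda>y. push_quot R\<^sub>Z (L y))"
    by (simp add: push_quot_def affine_ext_def map_bind_pmf)
  \<comment> \<open>Compatibility of \<open>L\<close> enters here, through
    \<open>quot_kernel_class\<close>. That lemma needs \<open>y \<in> Y\<close>, which holds because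
    \<open>bind_pmf_cong\<close> asks for agreement only on the support of
    \<open>\<mu>\<close>.\<close>
  also have "\<dots> = bind_pmf \<mu> (\<lambda>y. quot_kernel Y R\<^sub>Y R\<^sub>Z L (R\<^sub>Y `` {y}))"
    using assms(4)
    by (intro bind_pmf_cong refl quot_kernel_class[OF assms(1-3), symmetric])
       (auto simp: fin_dists_def)
  \<comment> \<open>The integrand now sees \<open>y\<close> only through its class, so this is a
    change of variables along the quotient map.\<close>
  also have "\<dots> = affine_ext (quot_kernel Y R\<^sub>Y R\<^sub>Z L) (push_quot R\<^sub>Y \<mu>)"
    by (simp add: push_quot_def affine_ext_def bind_map_pmf)
  finally show ?thesis .
qed

theorem theorem2:
  fixes X :: "'a set" and Y :: "'b set" and Z :: "'c set"
    and R\<^sub>X :: "'a rel" and R\<^sub>Y :: "'b rel" and R\<^sub>Z :: "'c rel"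
    and K :: "'a \<Rightarrow> 'b pmf" and L :: "'b \<Rightarrow> 'c pmf"
  assumes "equiv X R\<^sub>X" and "equiv Y R\<^sub>Y" and "equiv Z R\<^sub>Z"
    and "K \<in> compatible_kernels X R\<^sub>X Y R\<^sub>Y"
    and "L \<in> compatible_kernels Y R\<^sub>Y Z R\<^sub>Z"
  shows "seq_comp X K L \<in> compatible_kernels X R\<^sub>X Z R\<^sub>Z
    \<and> quot_kernel X R\<^sub>X R\<^sub>Z (seq_comp X K L)
        = seq_comp (X // R\<^sub>X) (quot_kernel X R\<^sub>X R\<^sub>Y K) (quot_kernel Y R\<^sub>Y R\<^sub>Z L)"
proof
  have K: "K \<in> kernels X Y" and L: "L \<in> kernels Y Z"
    using assms(4,5) by (auto simp: compatible_kernels_def)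
  have KL: "seq_comp X K L \<in> kernels X Z"
    using K L by (rule seq_comp_in_kernels)
  have Kx: "K x \<in> fin_dists Y" and KLx: "seq_comp X K L x \<in> fin_dists Z" if "x \<in> X" for x
    using that K KL by (auto simp: kernels_def)
  have push: "push_quot R\<^sub>Z (seq_comp X K L x)
      = affine_ext (quot_kernel Y R\<^sub>Y R\<^sub>Z L) (push_quot R\<^sub>Y (K x))" if "x \<in> X" for x
    using that push_quot_affine_ext[OF assms(2,3,5) Kx[OF that]] by (simp add: seq_comp_def)
  have "class_eq Z R\<^sub>Z (seq_comp X K L x) (seq_comp X K L x')" if "(x, x') \<in> R\<^sub>X" for x x'
  proof -
    have X: "x \<in> X" "x' \<in> X"
      using that equiv_type[OF assms(1)] by auto
    have "class_eq Y R\<^sub>Y (K x) (K x')"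
      using that assms(4) by (simp add: compatible_kernels_def)
    then have "push_quot R\<^sub>Y (K x) = push_quot R\<^sub>Y (K x')"
      using class_eq_iff_push_quot[OF assms(2) Kx[OF X(1)] Kx[OF X(2)]] by simp
    \<comment> \<open>By \<open>push\<close>, equal pushforwards of \<open>K x\<close> and
      \<open>K x'\<close> give equal pushforwards of the composites.\<close>
    then show ?thesis
      using class_eq_iff_push_quot[OF assms(3) KLx[OF X(1)] KLx[OF X(2)]] X by (simp add: push)
  qed
  with KL show compat: "seq_comp X K L \<in> compatible_kernels X R\<^sub>X Z R\<^sub>Z"
    by (simp add: compatible_kernels_def)
  show "quot_kernel X R\<^sub>X R\<^sub>Z (seq_comp X K L)
      = seq_comp (X // R\<^sub>X) (quot_kernel X R\<^sub>X R\<^sub>Y K) (quot_kernel Y R\<^sub>Y R\<^sub>Z L)"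
  proof
    fix C
    show "quot_kernel X R\<^sub>X R\<^sub>Z (seq_comp X K L) C
        = seq_comp (X // R\<^sub>X) (quot_kernel X R\<^sub>X R\<^sub>Y K) (quot_kernel Y R\<^sub>Y R\<^sub>Z L) C"
    proof (cases "C \<in> X // R\<^sub>X")
      case True
      then obtain x where x: "x \<in> X" "C = R\<^sub>X `` {x}" by (rule quotientE)
      \<comment> \<open>\<open>compat\<close> allows the composite's quotient kernel to be evaluated
        at \<open>x\<close> instead of the representative picked by \<open>SOME\<close>;
        \<open>push\<close> then matches the two sides.\<close>
      show ?thesis
        using True quot_kernel_class[OF assms(1,3) compat x(1)]
          quot_kernel_class[OF assms(1,2,4) x(1)] push[OF x(1)]
        unfolding x(2) by (simp add: seq_comp_def)
    next
      \<comment> \<open>Off the quotient set both restricted functions take the value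
        \<open>undefined\<close>.\<close>
      case False
      then show ?thesis by (simp add: quot_kernel_def seq_comp_def)
    qed
  qed
qed

end
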